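(* Let $q,d,r$ be positive integers with $1\leq q<d$, let $\Phi=(\varphi_1,\ldots,\varphi_q)$ be a $q$-tuple of (not necessarily bounded) holomorphic functions on $\mathbb D^d$, and let $F=(f_1,\ldots,f_r)$ with $f_1,\ldots,f_r\in\mathcal D_\infty(\Phi)$. Then the closed subspace $$\mathcal M_\Phi(F)=\overline{\operatorname{span}}\{\Phi^\alpha f_j:\alpha\in\mathbb N_0^q,\ 1\leq j\leq r\},$$ where the closure is taken in the $H^2(\mathbb D^d)$ norm, has infinite codimension in $H^2(\mathbb D^d)$.
   Context: $\mathbb D\subset\mathbb C$ is the open unit disk, $\mathbb D^d$ is the polydisk, and $\mathbb N_0=\{0,1,2,\ldots\}$. The Hardy space $H^2(\mathbb D^d)$ is the Hilbert space of holomorphic functions $f(z)=\sum_{\alpha\in\mathbb N_0^d}a_\alpha z^\alpha$ on $\mathbb D^d$ with $\|f\|^2=\sum_\alpha|a_\alpha|^2<\infty$, where $z^\alpha=z_1^{\alpha_1}\cdots z_d^{\alpha_d}$. For a tuple $\Phi=(\varphi_1,\ldots,\varphi_q)$ of holomorphic functions on $\mathbb D^d$ and $\alpha\in\mathbb N_0^q$, put $\Phi^\alpha=\prod_{\ell=1}^q\varphi_\ell^{\alpha_\ell}$ and $$\mathcal D_\infty(\Phi)=\{f\in H^2(\mathbb D^d):\Phi^\alpha f\in H^2(\mathbb D^d)\text{ for every }\alpha\in\mathbb N_0^q\}.$$ The codimension of a closed subspace is the dimension of the quotient space. *)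

theory Defs
  imports
    "HOL-Analysis.Analysis"
    "HOL-Library.Function_Algebras"
    "HOL-Library.Extended_Nat"
begin

definition fscale :: "complex \<Rightarrow> ('a \<Rightarrow> complex) \<Rightarrow> 'a \<Rightarrow> complex" where
  "fscale c f = (\<lambda>x. c * f x)"

interpretation fun_vs: vector_space "fscale :: complex \<Rightarrow> ('a \<Rightarrow> complex) \<Rightarrow> 'a \<Rightarrow> complex"
  by unfold_locales (simp_all add: fscale_def fun_eq_iff algebra_simps)

definition coset :: "('a \<Rightarrow> complex) set \<Rightarrow> ('a \<Rightarrow> complex) \<Rightarrow> ('a \<Rightarrow> complex) set" where
  "coset M f = (\<lambda>m. f + m) ` M"

text \<open>The cosets of the elements of \<open>B\<close> form a basis of the quotient space \<open>V / M\<close>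
  (for subspaces \<open>M \<subseteq> V\<close>). The quotient is the set of cosets \<open>coset M ` V\<close>; since the quotient map
  is linear, the linear combinations of the cosets of \<open>B\<close> are the cosets of the elements of the
  span of \<open>B\<close>. The last clause also forces distinct elements of \<open>B\<close> to have distinct cosets.\<close>

definition quotient_basis ::
    "('a \<Rightarrow> complex) set \<Rightarrow> ('a \<Rightarrow> complex) set \<Rightarrow> ('a \<Rightarrow> complex) set \<Rightarrow> bool" where
  "quotient_basis V M B \<longleftrightarrow>
     B \<subseteq> V \<and>
     coset M ` fun_vs.span B = coset M ` V \<and>
     (\<forall>T u. finite T \<and> T \<subseteq> B \<and> coset M (\<Sum>b\<in>T. fscale (u b) b) = coset M 0 \<longrightarrow> (\<forall>b\<in>T. u b = 0))"

definition codimension :: "('a \<Rightarrow> complex) set \<Rightarrow> ('a \<Rightarrow> complex) set \<Rightarrow> enat" where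
  "codimension V M =
     (if \<exists>B. finite B \<and> quotient_basis V M B
      then enat (card (SOME B. finite B \<and> quotient_basis V M B)) else \<infinity>)"

definition polydisk :: "(complex ^ 'n) set" where
  "polydisk = {z. \<forall>i. norm (z $ i) < 1}"

text \<open>Holomorphy in several variables: the derivative exists and is complex linear.\<close>

definition holomorphic_several :: "(complex ^ 'n \<Rightarrow> complex) \<Rightarrow> (complex ^ 'n) set \<Rightarrow> bool" where
  "holomorphic_several f S \<longleftrightarrow>
     (\<forall>z\<in>S. \<exists>c :: complex ^ 'n. (f has_derivative (\<lambda>h. \<Sum>i\<in>UNIV. c $ i * h $ i)) (at z))"

definition monomial :: "('n::finite \<Rightarrow> nat) \<Rightarrow> complex ^ 'n \<Rightarrow> complex" where
  "monomial \<alpha> z = (\<Prod>i\<in>UNIV. z $ i ^ \<alpha> i)"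

definition has_coeffs :: "(complex ^ 'n \<Rightarrow> complex) \<Rightarrow> (('n::finite \<Rightarrow> nat) \<Rightarrow> complex) \<Rightarrow> bool" where
  "has_coeffs f a \<longleftrightarrow> (\<forall>z\<in>polydisk. ((\<lambda>\<alpha>. a \<alpha> * monomial \<alpha> z) has_sum f z) UNIV)"

text \<open>HOL functions are total, so a function on the polydisk is represented by its extension by zero;
  in this way elements of the space are equal iff they agree on the polydisk.\<close>

definition hardy_space :: "(complex ^ 'n \<Rightarrow> complex) set" where
  "hardy_space =
     {f. holomorphic_several f polydisk \<and> (\<forall>z. z \<notin> polydisk \<longrightarrow> f z = 0) \<and>
         (\<exists>a. has_coeffs f a \<and> (\<lambda>\<alpha>. (cmod (a \<alpha>))\<^sup>2) summable_on UNIV)}"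

text \<open>The power series coefficients are unique, so the choice below involves no ambiguity.\<close>

definition hardy_coeff :: "(complex ^ 'n \<Rightarrow> complex) \<Rightarrow> ('n::finite \<Rightarrow> nat) \<Rightarrow> complex" where
  "hardy_coeff f = (SOME a. has_coeffs f a \<and> (\<lambda>\<alpha>. (cmod (a \<alpha>))\<^sup>2) summable_on UNIV)"

definition hardy_norm :: "(complex ^ 'n \<Rightarrow> complex) \<Rightarrow> real" where
  "hardy_norm f = sqrt (\<Sum>\<^sub>\<infinity>\<alpha>. (cmod (hardy_coeff f \<alpha>))\<^sup>2)"

definition hardy_closure :: "(complex ^ 'n \<Rightarrow> complex) set \<Rightarrow> (complex ^ 'n \<Rightarrow> complex) set" where
  "hardy_closure S = {g \<in> hardy_space. \<forall>\<epsilon>>0. \<exists>h\<in>S. hardy_norm (g - h) < \<epsilon>}"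

definition tuple_power ::
    "('q::finite \<Rightarrow> complex ^ 'n \<Rightarrow> complex) \<Rightarrow> ('q \<Rightarrow> nat) \<Rightarrow> complex ^ 'n \<Rightarrow> complex" where
  "tuple_power \<Phi> \<alpha> z = (\<Prod>l\<in>UNIV. \<Phi> l z ^ \<alpha> l)"

definition D_infinity ::
    "('q::finite \<Rightarrow> complex ^ 'n \<Rightarrow> complex) \<Rightarrow> (complex ^ 'n \<Rightarrow> complex) set" where
  "D_infinity \<Phi> = {f \<in> hardy_space. \<forall>\<alpha>. (\<lambda>z. tuple_power \<Phi> \<alpha> z * f z) \<in> hardy_space}"

definition generated_subspace ::
    "('q::finite \<Rightarrow> complex ^ 'n \<Rightarrow> complex) \<Rightarrow> ('r::finite \<Rightarrow> complex ^ 'n \<Rightarrow> complex) \<Rightarrow>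
     (complex ^ 'n \<Rightarrow> complex) set" where
  "generated_subspace \<Phi> F =
     hardy_closure (fun_vs.span {\<lambda>z. tuple_power \<Phi> \<alpha> z * F j z | \<alpha> j. True})"

end

theory Submission
  imports Defs
begin

text \<open>
  The proof counts Taylor coefficients at the origin: \<open>d\<close> variables produce more of them than \<open>q < d\<close>
  functions can fill.

  Put \<open>\<Psi> = \<Phi> - \<Phi>(0)\<close>. By the binomial formula the products \<open>\<Psi>\<^sup>\<alpha> f\<^sub>j\<close> span the same space as the products
  \<open>\<Phi>\<^sup>\<alpha> f\<^sub>j\<close> (\<open>tuple_power_translate_in_span\<close>), and \<open>\<Psi>\<^sup>\<alpha> f\<^sub>j\<close> vanishes at the origin to order at least the
  degree of \<open>\<alpha>\<close>, so its Taylor coefficients of smaller degree are zero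
  (\<open>tuple_power_mult_vanishing_order\<close>, \<open>coeff_eq_0_of_vanishing_order\<close>). Consider the \<open>n\<^sup>d\<close> coefficients
  whose index has all entries below \<open>n\<close>. Their degrees are below \<open>d n\<close>, so among the generators only
  the at most \<open>r (d n)\<^sup>q\<close> ones with all entries of \<open>\<alpha>\<close> below \<open>d n\<close> can have such a coefficient different
  from zero.

  Suppose finitely many functions \<open>B\<close> spanned the Hardy space modulo the closed subspace. As \<open>q < d\<close>, for
  large \<open>n\<close> the number \<open>n\<^sup>d\<close> exceeds \<open>\<bar>B\<bar> + r (d n)\<^sup>q\<close> (\<open>box_count\<close>), and linear algebra yields a
  nontrivial linear combination of these \<open>n\<^sup>d\<close> coefficient functionals that annihilates \<open>B\<close> and all
  generators. Coefficient functionals are continuous in the Hardy norm, so it annihilates the closed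
  subspace too (\<open>coeff_functional_eq_0_on_closure\<close>) and therefore the whole Hardy space. But its values on
  monomials are its weights, which are not all zero.

  The analytic ingredient is that a function vanishing to order \<open>m\<close> has no coefficients of degree below
  \<open>m\<close>; it also gives the uniqueness of coefficients, on which the linearity of the coefficient functionals rests.
\<close>

section \<open>Averages over roots of unity\<close>

text \<open>Let \<open>\<xi> = cis (2 * pi / N)\<close>. The average of the character \<open>j \<mapsto> \<xi> ^ (j * (p - q))\<close> over
  one period, which for positive \<open>N\<close> detects whether \<open>p\<close> and \<open>q\<close> are congruent modulo \<open>N\<close>. The power of the
  conjugate stands for the negative exponent, which keeps all exponents natural numbers.\<close>

definition root_average :: "nat \<Rightarrow> nat \<Rightarrow> nat \<Rightarrow> complex" where
  "root_average N p q =
     (\<Sum>j<N. (cis (2 * pi / N) ^ p * cnj (cis (2 * pi / N)) ^ q) ^ j) / of_nat N"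

lemma norm_root_average_le: "norm (root_average N p q) \<le> 1"
proof (cases "N = 0")
  case False
  have "norm (\<Sum>j<N. (cis (2 * pi / N) ^ p * cnj (cis (2 * pi / N)) ^ q) ^ j) \<le> of_nat (card {..<N}) * 1"
    by (rule order_trans[OF norm_sum], rule sum_bounded_above)
      (simp add: norm_mult norm_power)
  then show ?thesis
    using False by (simp add: root_average_def norm_divide divide_le_eq)
qed (simp add: root_average_def)

lemma cis_mult_cnj_power: "cis t ^ p * cnj (cis t) ^ p = 1"
  by (simp add: cis_cnj cis_mult flip: power_mult_distrib)

lemma root_average_same: "N > 0 \<Longrightarrow> root_average N p p = 1"
  by (simp add: root_average_def cis_mult_cnj_power)

lemma root_average_eq_0:
  assumes "N > 0" "p mod N \<noteq> q mod N"
  shows "root_average N p q = 0"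
proof -
  define \<xi> where "\<xi> = cis (2 * pi / N)"
  define w where "w = \<xi> ^ p * cnj \<xi> ^ q"
  have pow: "\<xi> ^ k = exp (2 * of_real pi * \<i> * of_nat k / of_nat N)" for k
    by (simp add: \<xi>_def cis_conv_exp field_simps flip: exp_of_nat_mult)
  have "\<xi> ^ p \<noteq> \<xi> ^ q"
    using complex_root_unity_eq[of N p q] assms by (simp add: pow)
  then have "w \<noteq> 1"
    using cis_mult_cnj_power[of "2 * pi / N" q]
    unfolding w_def \<xi>_def
    by (metis mult.commute mult.left_commute mult.right_neutral)
  have "\<xi> ^ N = 1"
    using complex_root_unity_eq_1[of N N] assms by (simp add: pow)
  then have "w ^ N = 1"
    by (simp add: w_def power_mult_distrib flip: power_mult complex_cnj_power)
       (simp add: power_mult mult.commute)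
  then have "(\<Sum>j<N. w ^ j) = 0"
    using \<open>w \<noteq> 1\<close> by (simp add: geometric_sum)
  then show ?thesis
    by (simp add: root_average_def w_def \<xi>_def)
qed

section \<open>Order of vanishing at the origin and Taylor coefficients\<close>

lemma has_sum_sum_finite:
  fixes f :: "'i \<Rightarrow> 'a \<Rightarrow> complex"
  assumes "finite K" "\<And>k. k \<in> K \<Longrightarrow> (f k has_sum s k) A"
  shows "((\<lambda>x. \<Sum>k\<in>K. f k x) has_sum (\<Sum>k\<in>K. s k)) A"
  using assms by (induction K rule: finite_induct) (auto intro!: has_sum_add)

lemma vec_const_mem_polydisk_iff: "(\<chi> i. c i) \<in> polydisk \<longleftrightarrow> (\<forall>i. norm (c i) < 1)"
  by (simp add: polydisk_def)

text \<open>A discrete form of Cauchy's coefficient formula. The function \<open>g\<close> is sampled on the torus of radius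
  \<open>\<rho>\<close> at the points whose coordinates are \<open>\<rho>\<close> times an \<open>N\<close>-th root of unity, and averaged against the
  character conjugate to \<open>z\<^sup>\<beta>\<close>. The average is bounded by the supremum of \<open>g\<close> on the torus, and it
  retains from the power series just the indices congruent to \<open>\<beta>\<close> modulo \<open>N\<close> in every
  coordinate. A finite average, unlike an integral, commutes with the multiple power series for
  trivial reasons.\<close>

lemma averaged_power_series:
  fixes g :: "complex ^ 'n \<Rightarrow> complex"
  assumes a: "has_coeffs g a" and "0 \<le> \<rho>" "\<rho> < 1" and N: "N > 0"
    and bound: "\<And>z. (\<And>i. norm (z $ i) = \<rho>) \<Longrightarrow> norm (g z) \<le> D"
  obtains A where "norm A \<le> D"
    "((\<lambda>\<gamma>. a \<gamma> * of_real \<rho> ^ sum \<gamma> UNIV * (\<Prod>i\<in>UNIV. root_average N (\<gamma> i) (\<beta> i))) has_sum A) UNIV"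
proof -
  define \<xi> where "\<xi> = cis (2 * pi / N)"
  define K where "K = PiE (UNIV :: 'n set) (\<lambda>_. {..<N})"
  define z :: "('n \<Rightarrow> nat) \<Rightarrow> complex ^ 'n" where "z k = (\<chi> i. of_real \<rho> * \<xi> ^ k i)" for k
  define c where "c k = (\<Prod>i\<in>UNIV. (cnj \<xi> ^ \<beta> i) ^ k i / of_nat N)" for k :: "'n \<Rightarrow> nat"
  define A where "A = (\<Sum>k\<in>K. g (z k) * c k)"
  have [simp]: "norm \<xi> = 1" by (simp add: \<xi>_def)
  have finK: "finite K" by (simp add: K_def finite_PiE)
  have cardK: "card K = N ^ CARD('n)" by (simp add: K_def card_PiE)
  have normc: "norm (c k) = 1 / of_nat N ^ CARD('n)" for k
    by (simp add: c_def norm_divide norm_power flip: prod_norm) (simp add: power_divide)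
  have zk: "z k \<in> polydisk" "norm (z k $ i) = \<rho>" for k i
    using assms by (simp_all add: z_def polydisk_def norm_mult norm_power)
  have "norm A \<le> (\<Sum>k\<in>K. norm (g (z k) * c k))"
    unfolding A_def by (rule norm_sum)
  also have "\<dots> \<le> (\<Sum>k\<in>K. D / of_nat N ^ CARD('n))"
    using bound[OF zk(2)] N by (intro sum_mono) (simp add: norm_mult normc divide_right_mono)
  also have "\<dots> = D" using N by (simp add: cardK)
  finally have 1: "norm A \<le> D" .
  have average: "(\<Sum>k\<in>K. a \<gamma> * monomial \<gamma> (z k) * c k) =
     a \<gamma> * of_real \<rho> ^ sum \<gamma> UNIV * (\<Prod>i\<in>UNIV. root_average N (\<gamma> i) (\<beta> i))" for \<gamma>
  proof -
    have "(\<Prod>i\<in>UNIV. root_average N (\<gamma> i) (\<beta> i)) =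
        (\<Prod>i\<in>UNIV. \<Sum>j<N. (\<xi> ^ \<gamma> i * cnj \<xi> ^ \<beta> i) ^ j / of_nat N)"
      by (simp add: root_average_def \<xi>_def sum_divide_distrib)
    also have "\<dots> = (\<Sum>k\<in>K. \<Prod>i\<in>UNIV. (\<xi> ^ \<gamma> i * cnj \<xi> ^ \<beta> i) ^ k i / of_nat N)"
      unfolding K_def by (rule prod_sum_PiE) auto
    also have "\<dots> = (\<Sum>k\<in>K. (\<Prod>i\<in>UNIV. (\<xi> ^ k i) ^ \<gamma> i) * c k)"
      by (simp add: c_def power_mult_distrib flip: prod.distrib power_mult)
         (simp add: mult.commute)
    finally have "of_real \<rho> ^ sum \<gamma> UNIV * (\<Prod>i\<in>UNIV. root_average N (\<gamma> i) (\<beta> i)) =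
      (\<Sum>k\<in>K. of_real \<rho> ^ sum \<gamma> UNIV * (\<Prod>i\<in>UNIV. (\<xi> ^ k i) ^ \<gamma> i) * c k)"
      by (simp add: sum_distrib_left mult.assoc)
    also have "\<dots> = (\<Sum>k\<in>K. monomial \<gamma> (z k) * c k)"
      by (simp add: monomial_def z_def power_mult_distrib prod.distrib power_sum)
    finally show ?thesis by (simp add: sum_distrib_left mult.assoc)
  qed
  have "((\<lambda>\<gamma>. \<Sum>k\<in>K. a \<gamma> * monomial \<gamma> (z k) * c k) has_sum A) UNIV"
    unfolding A_def using a zk(1)
    by (intro has_sum_sum_finite finK has_sum_cmult_left) (auto simp: has_coeffs_def)
  then show ?thesis using 1 that by (simp add: average)
qed

text \<open>Take \<open>N\<close> larger than the degree of \<open>\<beta>\<close>. An index \<open>\<gamma> \<noteq> \<beta>\<close> congruent to \<open>\<beta>\<close> modulo \<open>N\<close> then dominates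
  \<open>\<beta>\<close> coordinatewise and so has larger degree. Hence averaging over the torus of radius \<open>\<rho>\<close> gives
  \<open>\<bar>a \<beta>\<bar> * \<rho> ^ b = O(\<rho> ^ m) + O(\<rho> ^ (b + 1))\<close> with \<open>b\<close> the degree of \<open>\<beta>\<close>, and \<open>b < m\<close> makes the right-hand side
  \<open>O(\<rho> ^ (b + 1))\<close>. Dividing by \<open>\<rho>\<^sup>b\<close> and letting \<open>\<rho>\<close> tend to \<open>0\<close> leaves \<open>a \<beta> = 0\<close>.\<close>

lemma coeff_eq_0_of_vanishing_order:
  fixes g :: "complex ^ 'n \<Rightarrow> complex"
  assumes a: "has_coeffs g a"
    and small: "\<forall>\<^sub>F z in nhds 0. norm (g z) \<le> C * norm z ^ m"
    and deg: "sum \<beta> UNIV < m"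
  shows "a \<beta> = 0"
proof -
  define b where "b = sum \<beta> UNIV"
  define N where "N = Suc b"
  define d where "d = real CARD('n)"
  have d: "d \<ge> 0" by (simp add: d_def)
  \<comment> \<open>Absolute convergence at the point with all coordinates \<open>1/2\<close> controls the tail of the averaged series.\<close>
  define S where "S = (\<Sum>\<^sub>\<infinity>\<gamma>\<in>UNIV - {\<beta>}. norm (a \<gamma>) * (1/2) ^ sum \<gamma> UNIV)"
  define C' where "C' = \<bar>C\<bar> * d ^ m + S * 2 ^ N"
  have "((\<lambda>\<gamma>. a \<gamma> * monomial \<gamma> (\<chi> i. 1/2)) has_sum g (\<chi> i. 1/2)) UNIV"
    using a by (simp add: has_coeffs_def vec_const_mem_polydisk_iff)
  from has_sum_imp_summable[OF this]
  have "(\<lambda>\<gamma>. norm (a \<gamma> * monomial \<gamma> (\<chi> i. 1/2))) summable_on UNIV"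
    by (simp only: summable_on_iff_abs_summable_on_complex)
  moreover have "norm (a \<gamma> * monomial \<gamma> (\<chi> i. 1/2)) = norm (a \<gamma>) * (1/2) ^ sum \<gamma> UNIV" for \<gamma>
    by (simp only: monomial_def norm_mult power_sum vec_lambda_beta norm_power prod_norm[symmetric])
      simp
  ultimately have "(\<lambda>\<gamma>. norm (a \<gamma>) * (1/2) ^ sum \<gamma> UNIV) summable_on UNIV"
    by simp
  then have "(\<lambda>\<gamma>. norm (a \<gamma>) * (1/2) ^ sum \<gamma> UNIV) summable_on (UNIV - {\<beta>})"
    by (rule summable_on_subset_banach) simp
  then have S: "((\<lambda>\<gamma>. norm (a \<gamma>) * (1/2) ^ sum \<gamma> UNIV) has_sum S) (UNIV - {\<beta>})"
    unfolding S_def by (rule has_sum_infsum)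
  have S0: "S \<ge> 0" unfolding S_def by (intro infsum_nonneg) auto
  obtain \<epsilon> where \<epsilon>: "\<epsilon> > 0" "\<And>z. norm z < \<epsilon> \<Longrightarrow> norm (g z) \<le> C * norm z ^ m"
    using small by (auto simp: eventually_nhds_metric)
  have main: "norm (a \<beta>) \<le> C' * \<rho>" if \<rho>: "0 < \<rho>" "\<rho> < 1/2" "d * \<rho> < \<epsilon>" for \<rho>
  proof -
    have bound: "norm (g z) \<le> \<bar>C\<bar> * d ^ m * \<rho> ^ m" if z: "\<And>i. norm (z $ i) = \<rho>" for z
    proof -
      have "norm z \<le> d * \<rho>"
        using L2_set_le_sum[of UNIV "\<lambda>i. norm (z $ i)"] z \<rho>(1) by (simp add: norm_vec_def d_def)
      then have "norm (g z) \<le> C * norm z ^ m" "norm z ^ m \<le> (d * \<rho>) ^ m"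
        using \<epsilon> that \<rho> by (auto intro!: power_mono)
      then have "norm (g z) \<le> \<bar>C\<bar> * (d * \<rho>) ^ m"
        by (intro order_trans[OF _ mult_mono[of C "\<bar>C\<bar>" "norm z ^ m"]]) auto
      then show ?thesis by (simp add: power_mult_distrib mult.assoc)
    qed
    define h where "h \<gamma> = a \<gamma> * of_real \<rho> ^ sum \<gamma> UNIV *
        (\<Prod>i\<in>UNIV. root_average N (\<gamma> i) (\<beta> i))" for \<gamma>
    obtain A where A: "norm A \<le> \<bar>C\<bar> * d ^ m * \<rho> ^ m" "(h has_sum A) UNIV"
      using averaged_power_series[OF a _ _ _ bound, of \<rho> N \<beta>] \<rho>
      unfolding h_def N_def by auto
    have h\<beta>: "h \<beta> = a \<beta> * of_real \<rho> ^ b"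
      by (simp add: h_def root_average_same N_def b_def)
    have "(h has_sum (A - h \<beta>)) (UNIV - {\<beta>})"
      using has_sum_Diff[OF A(2) has_sum_finite[of "{\<beta>}" h]] by simp
    moreover have "((\<lambda>\<gamma>. norm (a \<gamma>) * (1/2) ^ sum \<gamma> UNIV * (2 * \<rho>) ^ N) has_sum S * (2 * \<rho>) ^ N)
        (UNIV - {\<beta>})"
      by (intro has_sum_cmult_left S)
    moreover have "norm (h \<gamma>) \<le> norm (a \<gamma>) * (1/2) ^ sum \<gamma> UNIV * (2 * \<rho>) ^ N"
      if "\<gamma> \<in> UNIV - {\<beta>}" for \<gamma>
    proof (cases "\<forall>i. \<gamma> i mod N = \<beta> i mod N")
      case True
      have "\<beta> i \<le> \<gamma> i" for i
      proof -
        have "\<beta> i \<le> b" unfolding b_def by (rule member_le_sum) auto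
        then have "\<beta> i = \<beta> i mod N" by (simp add: N_def)
        then show ?thesis using True mod_less_eq_dividend by metis
      qed
      moreover from that obtain i where "\<gamma> i \<noteq> \<beta> i" by fastforce
      ultimately have "\<forall>i\<in>UNIV. \<beta> i \<le> \<gamma> i" "\<exists>i\<in>UNIV. \<beta> i < \<gamma> i"
        by (blast, metis UNIV_I le_neq_implies_less)
      then have "b < sum \<gamma> UNIV"
        unfolding b_def by (intro sum_strict_mono_ex1) auto
      then have pow: "(2 * \<rho>) ^ sum \<gamma> UNIV \<le> (2 * \<rho>) ^ N"
        using \<rho> by (intro power_decreasing) (auto simp: N_def)
      have "norm (h \<gamma>) \<le> norm (a \<gamma>) * \<rho> ^ sum \<gamma> UNIV * 1"
      proof -
        have "norm (\<Prod>i\<in>UNIV. root_average N (\<gamma> i) (\<beta> i)) \<le> 1"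
          unfolding prod_norm[symmetric] by (intro prod_le_1) (simp add: norm_root_average_le)
        then show ?thesis
          unfolding h_def norm_mult using \<rho> by (intro mult_mono) (simp_all add: norm_power)
      qed
      also have "\<dots> = norm (a \<gamma>) * (1/2) ^ sum \<gamma> UNIV * (2 * \<rho>) ^ sum \<gamma> UNIV"
        by (simp add: field_simps)
      also have "\<dots> \<le> norm (a \<gamma>) * (1/2) ^ sum \<gamma> UNIV * (2 * \<rho>) ^ N"
        by (intro mult_left_mono pow) auto
      finally show ?thesis .
    next
      case False
      then have "h \<gamma> = 0"
        by (auto simp: h_def N_def intro: root_average_eq_0)
      then show ?thesis using \<rho> by simp
    qed
    ultimately have tail: "norm (A - h \<beta>) \<le> S * (2 * \<rho>) ^ N" by (rule norm_infsum_le)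
    have "norm (a \<beta>) * \<rho> ^ b = norm (h \<beta>)" using \<rho> by (simp add: h\<beta> norm_mult norm_power)
    also have "\<dots> \<le> norm A + norm (A - h \<beta>)"
      using norm_triangle_ineq4[of A "A - h \<beta>"] by simp
    also have "\<dots> \<le> \<bar>C\<bar> * d ^ m * \<rho> ^ m + S * (2 * \<rho>) ^ N"
      using A(1) tail by simp
    also have "\<dots> \<le> \<bar>C\<bar> * d ^ m * \<rho> ^ N + S * (2 * \<rho>) ^ N"
      using deg \<rho> d S0 by (intro add_mono mult_left_mono power_decreasing) (auto simp: N_def b_def)
    also have "\<dots> = C' * \<rho> * \<rho> ^ b"
      by (simp add: C'_def N_def power_mult_distrib algebra_simps)
    finally show ?thesis using \<rho> by simp
  qed
  have "\<forall>\<^sub>F \<rho> in at_right 0. norm (a \<beta>) \<le> C' * \<rho>"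
  proof -
    have "Min {1/2, \<epsilon> / (d + 1)} > 0" using \<epsilon>(1) d by simp
    then have "\<forall>\<^sub>F \<rho> in at_right 0. \<rho> \<in> {0<..<Min {1/2, \<epsilon> / (d + 1)}}"
      by (rule eventually_at_right_real)
    then show ?thesis
    proof eventually_elim
      case (elim \<rho>)
      then have "\<rho> * (d + 1) < \<epsilon>" using d by (simp add: field_simps)
      then show ?case using elim by (intro main) (auto simp: algebra_simps)
    qed
  qed
  moreover have "((\<lambda>\<rho>. C' * \<rho>) \<longlongrightarrow> C' * 0) (at_right 0)"
    by (intro tendsto_intros)
  ultimately have "norm (a \<beta>) \<le> C' * 0"
    by (intro tendsto_lowerbound[where F = "at_right (0::real)"]) auto
  then show ?thesis by simp
qed

section \<open>The Hardy space as a vector space with continuous coefficients\<close>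

text \<open>The difference of two expansions of \<open>f\<close> represents the zero function, which vanishes to every order.\<close>

lemma has_coeffs_unique:
  fixes f :: "complex ^ 'n \<Rightarrow> complex"
  assumes "has_coeffs f a" "has_coeffs f b"
  shows "a = b"
proof
  fix \<beta>
  have "((\<lambda>\<gamma>. a \<gamma> * monomial \<gamma> z + (- 1) * (b \<gamma> * monomial \<gamma> z)) has_sum f z + (- 1) * f z) UNIV"
    if "z \<in> polydisk" for z
    using assms that by (intro has_sum_add has_sum_cmult_right) (auto simp: has_coeffs_def)
  then have "has_coeffs (\<lambda>_. 0) (\<lambda>\<gamma>. a \<gamma> - b \<gamma>)"
    by (simp add: has_coeffs_def algebra_simps)
  then have "a \<beta> - b \<beta> = 0"
    by (rule coeff_eq_0_of_vanishing_order[where C = 0 and m = "Suc (sum \<beta> UNIV)"]) auto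
  then show "a \<beta> = b \<beta>" by simp
qed

lemma hardy_coeff_eqI:
  assumes "has_coeffs f a" "(\<lambda>\<alpha>. (cmod (a \<alpha>))\<^sup>2) summable_on UNIV"
  shows "hardy_coeff f = a"
  unfolding hardy_coeff_def using assms has_coeffs_unique by (intro some_equality) blast+

lemma hardy_coeff:
  assumes "f \<in> hardy_space"
  shows "has_coeffs f (hardy_coeff f)" "(\<lambda>\<alpha>. (cmod (hardy_coeff f \<alpha>))\<^sup>2) summable_on UNIV"
proof -
  obtain a where "has_coeffs f a" "(\<lambda>\<alpha>. (cmod (a \<alpha>))\<^sup>2) summable_on UNIV"
    using assms by (auto simp: hardy_space_def)
  with hardy_coeff_eqI show "has_coeffs f (hardy_coeff f)"
    "(\<lambda>\<alpha>. (cmod (hardy_coeff f \<alpha>))\<^sup>2) summable_on UNIV" by metis+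
qed

text \<open>Coefficient functionals are continuous, so annihilating a set by finitely many of them passes to
  the closure of the set.\<close>

lemma norm_hardy_coeff_le:
  assumes "f \<in> hardy_space"
  shows "norm (hardy_coeff f \<beta>) \<le> hardy_norm f"
  using finite_sum_le_infsum[OF hardy_coeff(2)[OF assms], of "{\<beta>}"]
  unfolding hardy_norm_def by (intro real_le_rsqrt) auto

lemma square_norm_add_le:
  fixes x y :: "'a::real_normed_vector"
  shows "(norm (x + y))\<^sup>2 \<le> 2 * (norm x)\<^sup>2 + 2 * (norm y)\<^sup>2"
proof -
  have "(norm (x + y))\<^sup>2 \<le> (norm x + norm y)\<^sup>2"
    by (intro power_mono norm_triangle_ineq) auto
  also have "\<dots> \<le> 2 * (norm x)\<^sup>2 + 2 * (norm y)\<^sup>2"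
    using sum_squares_bound[of "norm x" "norm y"] by (simp add: power2_sum)
  finally show ?thesis .
qed

lemma holomorphic_several_add:
  assumes "holomorphic_several f S" "holomorphic_several g S"
  shows "holomorphic_several (f + g) S"
  unfolding holomorphic_several_def
proof
  fix z assume "z \<in> S"
  then obtain c d where "(f has_derivative (\<lambda>h. \<Sum>i\<in>UNIV. c $ i * h $ i)) (at z)"
    "(g has_derivative (\<lambda>h. \<Sum>i\<in>UNIV. d $ i * h $ i)) (at z)"
    using assms \<open>z \<in> S\<close> unfolding holomorphic_several_def by blast
  from has_derivative_add[OF this]
  have "(f + g has_derivative (\<lambda>h. \<Sum>i\<in>UNIV. (c + d) $ i * h $ i)) (at z)"
    by (simp add: plus_fun_def sum.distrib algebra_simps)
  then show "\<exists>c. (f + g has_derivative (\<lambda>h. \<Sum>i\<in>UNIV. c $ i * h $ i)) (at z)" by blast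
qed

lemma holomorphic_several_fscale:
  assumes "holomorphic_several f S"
  shows "holomorphic_several (fscale k f) S"
  unfolding holomorphic_several_def
proof
  fix z assume "z \<in> S"
  then obtain c where "(f has_derivative (\<lambda>h. \<Sum>i\<in>UNIV. c $ i * h $ i)) (at z)"
    using assms \<open>z \<in> S\<close> unfolding holomorphic_several_def by blast
  from has_derivative_mult_right[OF this, of k]
  have "(fscale k f has_derivative (\<lambda>h. \<Sum>i\<in>UNIV. (\<chi> i. k * c $ i) $ i * h $ i)) (at z)"
    by (simp add: fscale_def sum_distrib_left mult.assoc)
  then show "\<exists>c. (fscale k f has_derivative (\<lambda>h. \<Sum>i\<in>UNIV. c $ i * h $ i)) (at z)" by blast
qed

lemma hardy_space_add:
  assumes f: "f \<in> hardy_space" and g: "g \<in> hardy_space"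
  shows "f + g \<in> hardy_space" "hardy_coeff (f + g) = (\<lambda>\<alpha>. hardy_coeff f \<alpha> + hardy_coeff g \<alpha>)"
proof -
  let ?a = "\<lambda>\<alpha>. hardy_coeff f \<alpha> + hardy_coeff g \<alpha>"
  have 1: "has_coeffs (f + g) ?a"
    using hardy_coeff(1)[OF f] hardy_coeff(1)[OF g]
    by (auto simp: has_coeffs_def distrib_right intro: has_sum_add)
  have "(\<lambda>\<alpha>. 2 * (cmod (hardy_coeff f \<alpha>))\<^sup>2 + 2 * (cmod (hardy_coeff g \<alpha>))\<^sup>2) summable_on UNIV"
    using hardy_coeff(2)[OF f] hardy_coeff(2)[OF g]
    by (intro summable_on_add summable_on_cmult_right)
  then have 2: "(\<lambda>\<alpha>. (cmod (?a \<alpha>))\<^sup>2) summable_on UNIV"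
    by (rule summable_on_comparison_test) (auto simp: square_norm_add_le)
  show "hardy_coeff (f + g) = ?a" using 1 2 by (rule hardy_coeff_eqI)
  show "f + g \<in> hardy_space"
    using f g 1 2 by (auto simp: hardy_space_def intro!: holomorphic_several_add)
qed

lemma hardy_space_fscale:
  assumes f: "f \<in> hardy_space"
  shows "fscale k f \<in> hardy_space" "hardy_coeff (fscale k f) = (\<lambda>\<alpha>. k * hardy_coeff f \<alpha>)"
proof -
  let ?a = "\<lambda>\<alpha>. k * hardy_coeff f \<alpha>"
  have 1: "has_coeffs (fscale k f) ?a"
    using hardy_coeff(1)[OF f]
    by (auto simp: has_coeffs_def fscale_def mult.assoc intro: has_sum_cmult_right)
  have "(\<lambda>\<alpha>. (cmod k)\<^sup>2 * (cmod (hardy_coeff f \<alpha>))\<^sup>2) summable_on UNIV"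
    using hardy_coeff(2)[OF f] by (intro summable_on_cmult_right)
  then have 2: "(\<lambda>\<alpha>. (cmod (?a \<alpha>))\<^sup>2) summable_on UNIV"
    by (simp add: norm_mult power_mult_distrib)
  show "hardy_coeff (fscale k f) = ?a" using 1 2 by (rule hardy_coeff_eqI)
  show "fscale k f \<in> hardy_space"
    using f 1 2 holomorphic_several_fscale[of f polydisk k]
    by (auto simp: hardy_space_def fscale_def)
qed

lemma open_polydisk: "open (polydisk :: (complex ^ 'n) set)"
proof -
  have "open (\<Inter>i. {z :: complex ^ 'n. norm (z $ i) < 1})"
    by (intro open_INT finite_UNIV ballI open_Collect_less continuous_intros finite)
  moreover have "(\<Inter>i. {z :: complex ^ 'n. norm (z $ i) < 1}) = polydisk"
    by (auto simp: polydisk_def)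
  ultimately show ?thesis by (rule subst[rotated])
qed

lemma holomorphic_several_monomial:
  "holomorphic_several (monomial \<beta> :: complex ^ 'n \<Rightarrow> complex) S"
  unfolding holomorphic_several_def
proof
  fix z :: "complex ^ 'n"
  have "(monomial \<beta> has_derivative (\<lambda>h. \<Sum>i\<in>UNIV. of_nat (\<beta> i) * h $ i * z $ i ^ (\<beta> i - 1) *
      (\<Prod>j\<in>UNIV - {i}. z $ j ^ \<beta> j))) (at z)"
    unfolding monomial_def
    by (intro has_derivative_prod has_derivative_power bounded_linear.has_derivative[OF bounded_linear_vec_nth] has_derivative_ident)
  then have "(monomial \<beta> has_derivative (\<lambda>h. \<Sum>i\<in>UNIV. (\<chi> i. of_nat (\<beta> i) * z $ i ^ (\<beta> i - 1) *
      (\<Prod>j\<in>UNIV - {i}. z $ j ^ \<beta> j)) $ i * h $ i)) (at z)"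
    by (simp add: mult_ac)
  then show "\<exists>c. (monomial \<beta> has_derivative (\<lambda>h. \<Sum>i\<in>UNIV. c $ i * h $ i)) (at z)" by blast
qed

text \<open>Elements of the Hardy space vanish off the polydisk, so the monomial must be cut off there.\<close>

definition hardy_monomial :: "('n::finite \<Rightarrow> nat) \<Rightarrow> complex ^ 'n \<Rightarrow> complex" where
  "hardy_monomial \<beta> z = (if z \<in> polydisk then monomial \<beta> z else 0)"

lemma hardy_monomial:
  "hardy_monomial \<beta> \<in> hardy_space"
  "hardy_coeff (hardy_monomial \<beta>) = (\<lambda>\<alpha>. if \<alpha> = \<beta> then 1 else 0)"
proof -
  let ?a = "\<lambda>\<alpha>. if \<alpha> = \<beta> then 1 else 0 :: complex"
  have 1: "has_coeffs (hardy_monomial \<beta>) ?a"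
    unfolding has_coeffs_def
    by (auto simp: hardy_monomial_def intro!: has_sum_finite_neutralI[of "{\<beta>}"] split: if_splits)
  have 2: "(\<lambda>\<alpha>. (cmod (?a \<alpha>))\<^sup>2) summable_on UNIV"
    by (rule finite_nonzero_values_imp_summable_on, rule finite_subset[of _ "{\<beta>}"]) auto
  show "hardy_coeff (hardy_monomial \<beta>) = ?a" using 1 2 by (rule hardy_coeff_eqI)
  have "holomorphic_several (hardy_monomial \<beta>) polydisk"
    unfolding holomorphic_several_def
  proof
    fix z :: "complex ^ 'a" assume z: "z \<in> polydisk"
    then obtain c where "(monomial \<beta> has_derivative (\<lambda>h. \<Sum>i\<in>UNIV. c $ i * h $ i)) (at z)"
      using holomorphic_several_monomial[of \<beta> polydisk] by (auto simp: holomorphic_several_def)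
    then have "(hardy_monomial \<beta> has_derivative (\<lambda>h. \<Sum>i\<in>UNIV. c $ i * h $ i)) (at z)"
      by (rule has_derivative_transform_within_open[OF _ open_polydisk z])
        (simp add: hardy_monomial_def)
    then show "\<exists>c. (hardy_monomial \<beta> has_derivative (\<lambda>h. \<Sum>i\<in>UNIV. c $ i * h $ i)) (at z)" by blast
  qed
  then show "hardy_monomial \<beta> \<in> hardy_space"
    unfolding hardy_space_def using 1 2 by (auto simp: hardy_monomial_def)
qed

lemma hardy_space_0: "0 \<in> hardy_space" and hardy_coeff_0: "hardy_coeff 0 = (\<lambda>_. 0)"
  using hardy_space_fscale[OF hardy_monomial(1), of 0] by (simp_all add: fscale_def zero_fun_def)

lemma hardy_norm_0: "hardy_norm 0 = 0"
  by (simp add: hardy_norm_def hardy_coeff_0)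

lemma subspace_hardy_space: "fun_vs.subspace hardy_space"
  by (auto simp: fun_vs.subspace_def hardy_space_0 hardy_space_add hardy_space_fscale)

section \<open>A linear system with more unknowns than equations\<close>

text \<open>Gaussian elimination: an equation with a nonzero coefficient at \<open>y\<close> is solved for the unknown \<open>u y\<close>
  and substituted into the others, which removes one equation and one unknown.\<close>

lemma homogeneous_system_nontrivial_solution:
  fixes A :: "'e \<Rightarrow> 'x \<Rightarrow> 'a::field"
  assumes "finite E" "finite X" "card E < card X"
  shows "\<exists>u. (\<exists>x\<in>X. u x \<noteq> 0) \<and> (\<forall>e\<in>E. (\<Sum>x\<in>X. u x * A e x) = 0)"
  using assms
proof (induction E arbitrary: X A rule: finite_induct)
  case empty
  then obtain x where "x \<in> X" by fastforce
  then show ?case by (intro exI[of _ "\<lambda>_. 1"]) auto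
next
  case (insert e E)
  show ?case
  proof (cases "\<forall>x\<in>X. A e x = 0")
    case True
    have "card E < card X" using insert by simp
    with insert.IH[of X A] insert.prems True show ?thesis by auto
  next
    case False
    then obtain y where y: "y \<in> X" "A e y \<noteq> 0" by blast
    define A' where "A' e' x = A e' x - A e' y * A e x / A e y" for e' x
    have "card E < card (X - {y})" using insert y by simp
    with insert.IH[of "X - {y}" A'] insert.prems obtain u where u:
      "\<exists>x\<in>X - {y}. u x \<noteq> 0" "\<And>e'. e' \<in> E \<Longrightarrow> (\<Sum>x\<in>X - {y}. u x * A' e' x) = 0"
      by auto
    define t where "t = - (\<Sum>x\<in>X - {y}. u x * A e x) / A e y"
    define v where "v = u(y := t)"
    have sum_v: "(\<Sum>x\<in>X. v x * A e' x) = t * A e' y + (\<Sum>x\<in>X - {y}. u x * A e' x)" for e'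
      using y sum.remove[OF \<open>finite X\<close> y(1), of "\<lambda>x. v x * A e' x"] by (simp add: v_def)
    have "(\<Sum>x\<in>X. v x * A e' x) = 0" if "e' \<in> E" for e'
    proof -
      have "(\<Sum>x\<in>X - {y}. u x * A' e' x) =
          (\<Sum>x\<in>X - {y}. u x * A e' x) - (\<Sum>x\<in>X - {y}. u x * A e x) / A e y * A e' y"
        by (simp add: A'_def right_diff_distrib sum_subtractf sum_divide_distrib sum_distrib_left mult_ac)
      then show ?thesis using u(2)[OF that] by (simp add: sum_v t_def)
    qed
    moreover have "(\<Sum>x\<in>X. v x * A e x) = 0"
      using y by (simp add: sum_v t_def)
    moreover have "\<exists>x\<in>X. v x \<noteq> 0" using u(1) by (auto simp: v_def)
    ultimately show ?thesis by auto
  qed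
qed

section \<open>Powers of the translated tuple\<close>

lemma sum_fun_apply: "(\<Sum>a\<in>A. f a) x = (\<Sum>a\<in>A. f a x)"
  by (induction A rule: infinite_finite_induct) auto

text \<open>The multivariate binomial expansion. Applied with \<open>c\<close> and with \<open>- c\<close> it shows that translating a
  tuple by constants does not change the span of its powers times \<open>f\<close>.\<close>

lemma tuple_power_translate_in_span:
  fixes \<Psi> :: "'q::finite \<Rightarrow> complex ^ 'n \<Rightarrow> complex"
  shows "(\<lambda>z. tuple_power (\<lambda>l z. \<Psi> l z + c l) \<alpha> z * f z)
    \<in> fun_vs.span {\<lambda>z. tuple_power \<Psi> \<gamma> z * f z | \<gamma>. True}"
proof -
  define K where "K = PiE (UNIV :: 'q set) (\<lambda>l. {..\<alpha> l})"
  define w where "w \<gamma> = (\<Prod>l\<in>UNIV. of_nat (\<alpha> l choose \<gamma> l) * c l ^ (\<alpha> l - \<gamma> l))" for \<gamma>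
  have "tuple_power (\<lambda>l z. \<Psi> l z + c l) \<alpha> z = (\<Sum>\<gamma>\<in>K. w \<gamma> * tuple_power \<Psi> \<gamma> z)" for z
  proof -
    have "tuple_power (\<lambda>l z. \<Psi> l z + c l) \<alpha> z =
        (\<Prod>l\<in>UNIV. \<Sum>k\<le>\<alpha> l. of_nat (\<alpha> l choose k) * \<Psi> l z ^ k * c l ^ (\<alpha> l - k))"
      by (simp add: tuple_power_def binomial_ring)
    also have "\<dots> = (\<Sum>\<gamma>\<in>K. \<Prod>l\<in>UNIV. of_nat (\<alpha> l choose \<gamma> l) * \<Psi> l z ^ \<gamma> l * c l ^ (\<alpha> l - \<gamma> l))"
      unfolding K_def by (rule prod_sum_PiE) auto
    also have "\<dots> = (\<Sum>\<gamma>\<in>K. w \<gamma> * tuple_power \<Psi> \<gamma> z)"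
      by (simp add: w_def tuple_power_def prod.distrib mult_ac)
    finally show ?thesis .
  qed
  then have "(\<lambda>z. tuple_power (\<lambda>l z. \<Psi> l z + c l) \<alpha> z * f z) =
      (\<Sum>\<gamma>\<in>K. fscale (w \<gamma>) (\<lambda>z. tuple_power \<Psi> \<gamma> z * f z))"
    by (simp add: fun_eq_iff sum_fun_apply fscale_def sum_distrib_right mult.assoc)
  also have "\<dots> \<in> fun_vs.span {\<lambda>z. tuple_power \<Psi> \<gamma> z * f z | \<gamma>. True}"
    by (intro fun_vs.span_sum fun_vs.span_scale fun_vs.span_base) blast
  finally show ?thesis .
qed

text \<open>Near \<open>z0\<close> the remainder of the first order expansion is at most \<open>norm (z - z0)\<close>, and the derivative is a
  bounded linear map.\<close>

lemma holomorphic_several_Lipschitz_at: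
  assumes "holomorphic_several f S" "z0 \<in> S"
  obtains K where "\<forall>\<^sub>F z in nhds z0. norm (f z - f z0) \<le> K * norm (z - z0)"
proof -
  obtain f' where f': "(f has_derivative f') (at z0)"
    using assms unfolding holomorphic_several_def by blast
  then have "\<forall>e>0. \<exists>d>0. \<forall>y. norm (y - z0) < d \<longrightarrow>
      norm (f y - f z0 - f' (y - z0)) \<le> e * norm (y - z0)"
    by (simp add: has_derivative_at_alt)
  from this[rule_format, OF zero_less_one] obtain d where d: "d > 0" "\<And>y. norm (y - z0) < d \<Longrightarrow>
      norm (f y - f z0 - f' (y - z0)) \<le> 1 * norm (y - z0)"
    by blast
  obtain B where B: "\<And>x. norm (f' x) \<le> norm x * B"
    using bounded_linear.bounded[OF has_derivative_bounded_linear[OF f']] by blast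
  have "norm (f z - f z0) \<le> (1 + B) * norm (z - z0)" if "dist z z0 < d" for z
  proof -
    have "norm (f z - f z0) \<le> norm (f z - f z0 - f' (z - z0)) + norm (f' (z - z0))"
      by (metis diff_add_cancel norm_triangle_ineq)
    also have "\<dots> \<le> 1 * norm (z - z0) + norm (z - z0) * B"
      using that by (intro add_mono d B) (simp add: dist_norm)
    finally show ?thesis by (simp add: algebra_simps)
  qed
  then have "\<forall>\<^sub>F z in nhds z0. norm (f z - f z0) \<le> (1 + B) * norm (z - z0)"
    unfolding eventually_nhds_metric using d(1) by auto
  then show ?thesis by (rule that)
qed

lemma zero_in_polydisk: "0 \<in> polydisk"
  by (simp add: polydisk_def)

text \<open>Each factor \<open>\<Psi> l z - \<Psi> l 0\<close> is \<open>O(norm z)\<close> and \<open>f\<close> is bounded near the origin, so the order of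
  vanishing is at least the number of factors.\<close>

lemma tuple_power_mult_vanishing_order:
  fixes \<Psi> :: "'q::finite \<Rightarrow> complex ^ 'n \<Rightarrow> complex"
  assumes \<Psi>: "\<And>l. holomorphic_several (\<Psi> l) polydisk" and f: "holomorphic_several f polydisk"
  obtains C where "\<forall>\<^sub>F z in nhds 0.
    norm (tuple_power (\<lambda>l z. \<Psi> l z - \<Psi> l 0) \<alpha> z * f z) \<le> C * norm z ^ sum \<alpha> UNIV"
proof -
  have "\<exists>K. \<forall>\<^sub>F z in nhds 0. norm (\<Psi> l z - \<Psi> l 0) \<le> K * norm z" for l
    using holomorphic_several_Lipschitz_at[OF \<Psi>[of l] zero_in_polydisk] by auto
  then have "\<forall>l. \<exists>K. \<forall>\<^sub>F z in nhds 0. norm (\<Psi> l z - \<Psi> l 0) \<le> K * norm z" by blast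
  from choice[OF this] obtain K where K: "\<And>l. \<forall>\<^sub>F z in nhds 0. norm (\<Psi> l z - \<Psi> l 0) \<le> K l * norm z"
    by blast
  have "isCont f 0"
  proof -
    obtain f' where "(f has_derivative f') (at 0)"
      using f zero_in_polydisk unfolding holomorphic_several_def by blast
    then show ?thesis by (rule has_derivative_continuous)
  qed
  then have "((\<lambda>z. norm (f z)) \<longlongrightarrow> norm (f 0)) (nhds 0)"
    by (intro tendsto_norm) (simp add: isCont_def tendsto_at_iff_tendsto_nhds)
  then have f_le: "\<forall>\<^sub>F z in nhds 0. norm (f z) < norm (f 0) + 1"
    by (rule order_tendstoD) simp
  have all_le: "\<forall>\<^sub>F z in nhds 0. \<forall>l. norm (\<Psi> l z - \<Psi> l 0) \<le> K l * norm z"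
    by (intro eventually_all_finite K)
  have "\<forall>\<^sub>F z in nhds 0. norm (tuple_power (\<lambda>l z. \<Psi> l z - \<Psi> l 0) \<alpha> z * f z)
      \<le> ((\<Prod>l\<in>UNIV. K l ^ \<alpha> l) * (norm (f 0) + 1)) * norm z ^ sum \<alpha> UNIV"
    using f_le all_le
  proof eventually_elim
    case (elim z)
    have "norm (tuple_power (\<lambda>l z. \<Psi> l z - \<Psi> l 0) \<alpha> z) = (\<Prod>l\<in>UNIV. norm (\<Psi> l z - \<Psi> l 0) ^ \<alpha> l)"
      by (simp add: tuple_power_def norm_power flip: prod_norm)
    also have "\<dots> \<le> (\<Prod>l\<in>UNIV. (K l * norm z) ^ \<alpha> l)"
      using elim by (intro prod_mono conjI power_mono) auto
    also have "\<dots> = (\<Prod>l\<in>UNIV. K l ^ \<alpha> l) * norm z ^ sum \<alpha> UNIV"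
      by (simp add: power_mult_distrib prod.distrib power_sum)
    finally have "norm (tuple_power (\<lambda>l z. \<Psi> l z - \<Psi> l 0) \<alpha> z) * norm (f z)
        \<le> ((\<Prod>l\<in>UNIV. K l ^ \<alpha> l) * norm z ^ sum \<alpha> UNIV) * (norm (f 0) + 1)"
      using elim by (intro mult_mono') auto
    then show ?case by (simp add: norm_mult mult_ac)
  qed
  then show ?thesis by (rule that)
qed

section \<open>Closure and codimension\<close>

lemma mem_hardy_closure: "S \<subseteq> hardy_space \<Longrightarrow> f \<in> S \<Longrightarrow> f \<in> hardy_closure S"
proof -
  assume S: "S \<subseteq> hardy_space" and f: "f \<in> S"
  have "\<exists>h\<in>S. hardy_norm (f - h) < \<epsilon>" if "\<epsilon> > 0" for \<epsilon>
    using f that by (intro bexI[of _ f]) (simp_all add: hardy_norm_0)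
  then show "f \<in> hardy_closure S" using S f by (auto simp: hardy_closure_def)
qed

lemma coeff_functional_eq_0_on_closure:
  assumes S: "S \<subseteq> hardy_space" and g: "g \<in> hardy_closure S" and X: "finite X"
    and zero: "\<And>f. f \<in> S \<Longrightarrow> (\<Sum>\<beta>\<in>X. u \<beta> * hardy_coeff f \<beta>) = 0"
  shows "(\<Sum>\<beta>\<in>X. u \<beta> * hardy_coeff g \<beta>) = 0"
proof -
  define L where "L = (\<Sum>\<beta>\<in>X. norm (u \<beta>))"
  let ?s = "norm (\<Sum>\<beta>\<in>X. u \<beta> * hardy_coeff g \<beta>)"
  have "?s \<le> 0 + \<epsilon>" if "\<epsilon> > 0" for \<epsilon>
  proof -
    have L: "L \<ge> 0" by (simp add: L_def sum_nonneg)
    have "\<epsilon> / (L + 1) > 0" using that L by simp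
    then obtain h where h: "h \<in> S" "hardy_norm (g - h) < \<epsilon> / (L + 1)" "g \<in> hardy_space"
      using g by (auto simp: hardy_closure_def)
    define k where "k = g - h"
    have hH: "h \<in> hardy_space" using S h(1) by blast
    have "g + fscale (- 1) h \<in> hardy_space"
      by (rule hardy_space_add(1)[OF h(3) hardy_space_fscale(1)[OF hH]])
    also have "g + fscale (- 1) h = k" by (simp add: k_def fscale_def fun_eq_iff)
    finally have k: "k \<in> hardy_space" .
    have "h + k = g" by (simp add: k_def)
    then have "hardy_coeff g = (\<lambda>\<alpha>. hardy_coeff h \<alpha> + hardy_coeff k \<alpha>)"
      using hardy_space_add(2)[OF hH k] by simp
    then have "?s = norm (\<Sum>\<beta>\<in>X. u \<beta> * hardy_coeff k \<beta>)"
      using zero[OF h(1)] by (simp add: distrib_left sum.distrib)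
    also have "\<dots> \<le> (\<Sum>\<beta>\<in>X. norm (u \<beta>) * hardy_norm k)"
      using norm_hardy_coeff_le[OF k]
      by (intro sum_norm_le) (simp add: norm_mult mult_left_mono)
    also have "\<dots> = L * hardy_norm k" by (simp add: L_def sum_distrib_right)
    also have "\<dots> \<le> L * (\<epsilon> / (L + 1))" using h(2) L by (intro mult_left_mono) (auto simp: k_def)
    also have "\<dots> \<le> \<epsilon>" using L that by (simp add: field_simps)
    finally show ?thesis by simp
  qed
  then have "?s \<le> 0" by (rule field_le_epsilon)
  then show ?thesis by simp
qed

text \<open>A finite basis \<open>B\<close> of the quotient would write every element of \<open>V\<close> as a sum of elements of \<open>span B\<close>
  and of \<open>M\<close>.\<close>

lemma codimension_infiniteI:
  assumes "0 \<in> M"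
    and "\<And>B. finite B \<Longrightarrow> B \<subseteq> V \<Longrightarrow> \<exists>v\<in>V. \<forall>b\<in>fun_vs.span B. \<forall>m\<in>M. v \<noteq> b + m"
  shows "codimension V M = \<infinity>"
proof -
  have "\<not> quotient_basis V M B" if fin: "finite B" for B
  proof
    assume B: "quotient_basis V M B"
    then have "B \<subseteq> V" and eq: "coset M ` fun_vs.span B = coset M ` V"
      unfolding quotient_basis_def by - (elim conjE, assumption)+
    from assms(2)[OF fin this(1)] obtain v where
      v: "v \<in> V" "\<forall>b\<in>fun_vs.span B. \<forall>m\<in>M. v \<noteq> b + m" by blast
    have "coset M v \<in> coset M ` V" using v(1) by (rule imageI)
    also have "coset M ` V = coset M ` fun_vs.span B" by (rule eq[symmetric])
    finally obtain b where b: "b \<in> fun_vs.span B" "coset M v = coset M b" by (rule imageE)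
    have "v \<in> coset M v"
      unfolding coset_def using assms(1) by (rule rev_image_eqI) simp
    then have "v \<in> coset M b" by (simp only: b(2))
    then obtain m where "v = b + m" "m \<in> M" unfolding coset_def by (rule imageE)
    then show False using b(1) v(2) by blast
  qed
  then have "\<nexists>B. finite B \<and> quotient_basis V M B" by blast
  then show ?thesis unfolding codimension_def by (simp only: if_False)
qed

lemma finite_multi_indices: "finite {\<alpha> :: 'i::finite \<Rightarrow> nat. \<forall>l. \<alpha> l < k}"
  and card_multi_indices: "card {\<alpha> :: 'i \<Rightarrow> nat. \<forall>l. \<alpha> l < k} = k ^ CARD('i)"
proof -
  have "{\<alpha> :: 'i \<Rightarrow> nat. \<forall>l. \<alpha> l < k} = PiE UNIV (\<lambda>_. {..<k})"
    by (auto simp: PiE_def)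
  then show "finite {\<alpha> :: 'i \<Rightarrow> nat. \<forall>l. \<alpha> l < k}"
    "card {\<alpha> :: 'i \<Rightarrow> nat. \<forall>l. \<alpha> l < k} = k ^ CARD('i)"
    by (simp_all add: card_PiE finite_PiE)
qed

text \<open>The left-hand side grows in \<open>n\<close> like a polynomial of degree \<open>q\<close>, the right-hand side has degree \<open>d > q\<close>.
  In the application \<open>n\<^sup>d\<close> counts the Taylor coefficients used, and the left-hand side counts the linear
  conditions on them: \<open>s\<close> from a supposed basis of the quotient, and \<open>r\<close> for each power of the tuple
  that can have a nonzero coefficient among them.\<close>

lemma box_count:
  fixes q d r s :: nat
  assumes "q < d"
  obtains n where "s + (d * n) ^ q * r < n ^ d"
proof -
  define n where "n = s + d ^ q * r + 1"
  have pos: "n ^ q \<ge> 1" by (rule one_le_power) (simp add: n_def)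
  have "s + (d * n) ^ q * r = s + n ^ q * (d ^ q * r)"
    by (simp only: power_mult_distrib mult_ac)
  also have "\<dots> \<le> n ^ q * s + n ^ q * (d ^ q * r)"
    using mult_le_mono1[OF pos, of s] by simp
  also have "\<dots> < n ^ q * (s + d ^ q * r + 1)"
    using pos unfolding distrib_left by linarith
  also have "\<dots> = n ^ Suc q" by (simp only: n_def power_Suc2)
  also have "\<dots> \<le> n ^ d"
    using assms pos by (intro power_increasing) (simp_all add: n_def)
  finally show ?thesis by (rule that)
qed

section \<open>Infinite codimension\<close>

theorem corollary2p3:
  fixes \<Phi> :: "'q::finite \<Rightarrow> complex ^ 'd \<Rightarrow> complex"
    and F :: "'r::finite \<Rightarrow> complex ^ 'd \<Rightarrow> complex"
  assumes "CARD('q) < CARD('d)"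
    and "\<And>l. holomorphic_several (\<Phi> l) polydisk"
    and "\<And>j. F j \<in> D_infinity \<Phi>"
  shows "codimension hardy_space (generated_subspace \<Phi> F) = \<infinity>"
proof -
  define G where "G = {\<lambda>z. tuple_power \<Phi> \<alpha> z * F j z | \<alpha> j. True}"
  define \<Psi> where "\<Psi> l z = \<Phi> l z - \<Phi> l 0" for l z
  define g where "g \<alpha> j z = tuple_power \<Psi> \<alpha> z * F j z" for \<alpha> j z
  have "G \<subseteq> hardy_space" using assms(3) by (auto simp: G_def D_infinity_def)
  then have span_G: "fun_vs.span G \<subseteq> hardy_space"
    by (intro fun_vs.span_minimal subspace_hardy_space)
  \<comment> \<open>Expanding powers of \<open>\<Phi> - \<Phi>(0)\<close> keeps them in the span, hence in the Hardy space.\<close>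
  have g_hardy: "g \<alpha> j \<in> hardy_space" for \<alpha> j
  proof -
    have "g \<alpha> j \<in> fun_vs.span {\<lambda>z. tuple_power \<Phi> \<gamma> z * F j z | \<gamma>. True}"
      using tuple_power_translate_in_span[of \<Phi> "\<lambda>l. - \<Phi> l 0" \<alpha> "F j"]
      by (simp add: g_def[abs_def] \<Psi>_def[abs_def])
    also have "\<dots> \<subseteq> fun_vs.span G" by (intro fun_vs.span_mono) (auto simp: G_def)
    finally show ?thesis using span_G by blast
  qed
  have "G \<subseteq> fun_vs.span (range (\<lambda>(\<alpha>, j). g \<alpha> j))"
  proof
    fix f assume "f \<in> G"
    then obtain \<alpha> j where f: "f = (\<lambda>z. tuple_power \<Phi> \<alpha> z * F j z)" by (auto simp: G_def)
    have "f \<in> fun_vs.span {\<lambda>z. tuple_power \<Psi> \<gamma> z * F j z | \<gamma>. True}"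
      using tuple_power_translate_in_span[of \<Psi> "\<lambda>l. \<Phi> l 0" \<alpha> "F j"]
      by (simp add: f \<Psi>_def[abs_def])
    also have "\<dots> \<subseteq> fun_vs.span (range (\<lambda>(\<alpha>, j). g \<alpha> j))"
      by (intro fun_vs.span_mono) (auto simp: g_def[abs_def])
    finally show "f \<in> fun_vs.span (range (\<lambda>(\<alpha>, j). g \<alpha> j))" .
  qed
  then have span_g: "fun_vs.span G \<subseteq> fun_vs.span (range (\<lambda>(\<alpha>, j). g \<alpha> j))"
    by (intro fun_vs.span_minimal fun_vs.subspace_span)
  have vanish: "hardy_coeff (g \<alpha> j) \<beta> = 0" if less: "sum \<beta> UNIV < sum \<alpha> UNIV" for \<alpha> \<beta> j
  proof -
    have "holomorphic_several (F j) polydisk"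
      using assms(3) by (simp add: D_infinity_def hardy_space_def)
    then obtain C where "\<forall>\<^sub>F z in nhds 0. norm (g \<alpha> j z) \<le> C * norm z ^ sum \<alpha> UNIV"
      using tuple_power_mult_vanishing_order[of \<Phi> "F j" \<alpha>] assms(2)
      unfolding g_def \<Psi>_def by blast
    then show ?thesis
      using coeff_eq_0_of_vanishing_order[OF hardy_coeff(1)[OF g_hardy] _ less] by blast
  qed
  have "\<exists>v\<in>hardy_space. \<forall>b\<in>fun_vs.span B. \<forall>m\<in>hardy_closure (fun_vs.span G). v \<noteq> b + m"
    if B: "finite B" "B \<subseteq> hardy_space" for B
  proof -
    obtain n where n: "card B + (CARD('d) * n) ^ CARD('q) * CARD('r) < n ^ CARD('d)"
      using box_count[OF assms(1)] by blast
    \<comment> \<open>The \<open>n ^ d\<close> coefficients with index in the box \<open>X\<close> all have degree below \<open>d * n\<close>, where \<open>d\<close> is the number of variables. A generator \<open>g \<alpha> j\<close>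
      with \<open>\<alpha>\<close> outside \<open>Y\<close> vanishes to order at least \<open>d * n\<close>, so only those with \<open>\<alpha> \<in> Y\<close> can
      have a nonzero coefficient there.\<close>
    define X where "X = {\<beta> :: 'd \<Rightarrow> nat. \<forall>i. \<beta> i < n}"
    define Y where "Y = {\<alpha> :: 'q \<Rightarrow> nat. \<forall>l. \<alpha> l < CARD('d) * n}"
    define E where "E = B \<union> (\<lambda>(\<alpha>, j). g \<alpha> j) ` (Y \<times> UNIV)"
    have fin: "finite X" "finite Y" by (simp_all add: X_def Y_def finite_multi_indices)
    have "card E \<le> card B + card (Y \<times> (UNIV :: 'r set))"
      unfolding E_def using fin
      by (intro order_trans[OF card_Un_le] add_left_mono card_image_le) auto
    also have "\<dots> < card X"
      using n by (simp add: X_def Y_def card_multi_indices card_cartesian_product)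
    finally have "card E < card X" .
    then obtain u where u: "\<exists>\<beta>\<in>X. u \<beta> \<noteq> 0" "\<And>f. f \<in> E \<Longrightarrow> (\<Sum>\<beta>\<in>X. u \<beta> * hardy_coeff f \<beta>) = 0"
      using homogeneous_system_nontrivial_solution[of E X hardy_coeff] B fin by (auto simp: E_def)
    \<comment> \<open>The kernel of the functional with weights \<open>u\<close> contains the closed subspace and \<open>B\<close>, but not everything.\<close>
    define N where "N = {f \<in> hardy_space. (\<Sum>\<beta>\<in>X. u \<beta> * hardy_coeff f \<beta>) = 0}"
    have N: "fun_vs.subspace N"
      unfolding fun_vs.subspace_def
    proof (intro conjI ballI allI)
      show "0 \<in> N" by (simp add: N_def hardy_space_0 hardy_coeff_0)
      show "x + y \<in> N" if "x \<in> N" "y \<in> N" for x y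
        using that by (simp add: N_def hardy_space_add distrib_left sum.distrib)
      show "fscale c x \<in> N" if "x \<in> N" for c x
        using that by (simp add: N_def hardy_space_fscale mult.left_commute flip: sum_distrib_left)
    qed
    have "g \<alpha> j \<in> N" for \<alpha> j
    proof (cases "\<alpha> \<in> Y")
      case True
      then show ?thesis using u(2) by (auto simp: N_def g_hardy E_def)
    next
      case False
      then obtain l where l: "CARD('d) * n \<le> \<alpha> l" by (auto simp: Y_def not_less)
      have "hardy_coeff (g \<alpha> j) \<beta> = 0" if "\<beta> \<in> X" for \<beta>
      proof (rule vanish)
        have "sum \<beta> UNIV < (\<Sum>i\<in>(UNIV :: 'd set). n)"
          using that by (intro sum_strict_mono) (auto simp: X_def)
        also have "\<dots> \<le> \<alpha> l" using l by simp
        also have "\<dots> \<le> sum \<alpha> UNIV" by (rule member_le_sum) auto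
        finally show "sum \<beta> UNIV < sum \<alpha> UNIV" .
      qed
      then show ?thesis by (simp add: N_def g_hardy)
    qed
    then have "fun_vs.span (range (\<lambda>(\<alpha>, j). g \<alpha> j)) \<subseteq> N"
      by (intro fun_vs.span_minimal N) auto
    then have "fun_vs.span G \<subseteq> N" using span_g by blast
    then have "hardy_closure (fun_vs.span G) \<subseteq> N"
      using coeff_functional_eq_0_on_closure[OF span_G _ fin(1), of _ u]
      by (auto simp: N_def hardy_closure_def)
    moreover have "fun_vs.span B \<subseteq> N"
      using B u(2) by (intro fun_vs.span_minimal N) (auto simp: N_def E_def)
    ultimately have in_N: "b + m \<in> N" if "b \<in> fun_vs.span B" "m \<in> hardy_closure (fun_vs.span G)" for b m
      using that N by (auto simp: fun_vs.subspace_def)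
    \<comment> \<open>The functional takes the value \<open>u \<beta>\<close> at the monomial with exponent \<open>\<beta>\<close>.\<close>
    from u(1) obtain \<beta> where \<beta>: "\<beta> \<in> X" "u \<beta> \<noteq> 0" by blast
    then have "hardy_monomial \<beta> \<notin> N"
      using fin(1) by (simp add: N_def hardy_monomial(2) if_distrib cong: if_cong)
    then show ?thesis
      using in_N hardy_monomial(1)[of \<beta>] by metis
  qed
  moreover have "0 \<in> hardy_closure (fun_vs.span G)"
    by (intro mem_hardy_closure span_G fun_vs.span_zero)
  ultimately show ?thesis
    unfolding generated_subspace_def G_def[symmetric] by (intro codimension_infiniteI) auto
qed

end
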